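(* For every chained matrix composition $\mathbf{a}\in\overline{\mathfrak{M}_d}^{\mathrm{chain}}$ and every $Z\in\mathrm{evZ}$, the entire matrix $$\left(\langle\mathsf{SS}_{(0,0);\boldsymbol{r}}(Z),\mathbf{a}\rangle\right)_{\boldsymbol{r}\leq\mathsf{size}(Z)}$$ can be evaluated in linear time, i.e. with $$\mathcal{O}\left(\mathsf{rows}(\mathbf{a})\cdot\mathsf{cols}(\mathbf{a})\cdot\mathsf{rows}(Z)\cdot\mathsf{cols}(Z)\right)$$ arithmetic operations. In particular, so can $\langle\mathsf{SS}(Z),\mathbf{a}\rangle$.
   Context: $\mathbb{K}$ is an integral domain, $\mathbb{N}=\{1,2,\ldots\}$, $d\in\mathbb{N}$ is fixed; $\mathbb{N}^2$ carries the product order. Arithmetic operations are operations in $\mathbb{K}$; evaluating a factor $Z_{\boldsymbol{i}}^{(\lambda)}$ (see below) counts as one operation. $(\mathfrak{M}_d,\star,\varepsilon)$ is the free commutative monoid generated by $d$ letters $\mathbf{1},\ldots,\mathbf{d}$. A non-empty matrix composition is a matrix $\mathbf{a}\in\mathfrak{M}_d^{m\times n}$ ($m,n\geq1$) such that no row and no column consists only of entries $\varepsilon$; write $\mathsf{rows}(\mathbf{a})=m$, $\mathsf{cols}(\mathbf{a})=n$. For non-empty compositions $\mathbf{a},\mathbf{b}$ define the chaining operations: $\mathrm{chain}_0(\mathbf{a},\mathbf{b})=\mathrm{diag}(\mathbf{a},\mathbf{b})$ is the block diagonal matrix with blocks $\mathbf{a},\mathbf{b}$ and $\varepsilon$ elsewhere;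 $\mathrm{chain}_1(\mathbf{a},\mathbf{b})$ is the matrix with $\mathsf{rows}(\mathbf{a})+\mathsf{rows}(\mathbf{b})-1$ rows and $\mathsf{cols}(\mathbf{a})+\mathsf{cols}(\mathbf{b})$ columns with $\mathbf{a}$ as its upper left block, $\mathbf{b}$ as its lower right block (so that the last row of $\mathbf{a}$ and the first row of $\mathbf{b}$ lie in the same row) and $\varepsilon$ elsewhere; $\mathrm{chain}_2(\mathbf{a},\mathbf{b})$ is the matrix with $\mathsf{rows}(\mathbf{a})+\mathsf{rows}(\mathbf{b})$ rows and $\mathsf{cols}(\mathbf{a})+\mathsf{cols}(\mathbf{b})-1$ columns with $\mathbf{a}$ as its upper left block, $\mathbf{b}$ as its lower right block (so that the last column of $\mathbf{a}$ and the first column of $\mathbf{b}$ lie in the same column) and $\varepsilon$ elsewhere. The set $\overline{\mathfrak{M}_d}^{\mathrm{chain}}$ of chained matrix compositions is the smallest set containing all $1\times1$ compositions $[\lambda]$, $\lambda\in\mathfrak{M}_d\setminus\{\varepsilon\}$, and closed under $\mathrm{chain}_a$ for all $a\in\{0,1,2\}$. $\mathrm{evZ}$ is the set of functions $Z:\mathbb{N}^2\to\mathbb{K}^d$ of finite support; $\mathsf{size}(Z)=(\mathsf{rows}(Z),\mathsf{cols}(Z))$ is the least $\boldsymbol{n}\in\mathbb{N}^2$ such that $Z_{\boldsymbol{i}}\neq0$ implies $\boldsymbol{i}\leq\boldsymbol{n}$. For $z\in\mathbb{K}^d$, $\lambda\mapsto z^{(\lambda)}$ is the monoid homomorphism from $\mathfrak{M}_d$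 to the multiplicative monoid of $\mathbb{K}$ with $z^{(\mathbf{j})}=z_j$. For $\mathbf{a}$ of size $m\times n$ and $\boldsymbol{r}\in\mathbb{N}^2$, $$\langle\mathsf{SS}_{(0,0);\boldsymbol{r}}(Z),\mathbf{a}\rangle=\sum_{\substack{0<\iota_1<\cdots<\iota_m\leq\boldsymbol{r}_1\\ 0<\kappa_1<\cdots<\kappa_n\leq\boldsymbol{r}_2}}\ \prod_{s=1}^{m}\prod_{t=1}^{n}Z_{\iota_s,\kappa_t}^{(\mathbf{a}_{s,t})},$$ and $\langle\mathsf{SS}(Z),\mathbf{a}\rangle$ is the same sum without upper bounds. *)

theory Defs
  imports
    "Jordan_Normal_Form.Matrix"
    "HOL-Library.Multiset"
    "HOL-Library.FuncSet"
    "HOL-Library.Product_Order"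
    "HOL-Library.Groups_Big_Fun"
    "HOL-Analysis.Finite_Cartesian_Product"
begin

hide_const (open) Finite_Cartesian_Product.mat

section \<open>Matrix compositions\<close>

text \<open>
  The free commutative monoid on the letters \<^typ>\<open>'d\<close> is \<^typ>\<open>'d multiset\<close>, with \<open>+\<close> as the product
  and \<open>{#}\<close> (which is \<open>0\<close>) as the neutral element. The number of letters is
  \<open>CARD('d)\<close>. Entries of a \<^typ>\<open>'d multiset mat\<close> are indexed from \<open>0\<close>.
\<close>

definition compositions :: "'d multiset mat set" where
  "compositions = {a. 1 \<le> dim_row a \<and> 1 \<le> dim_col a \<and>
     (\<forall>i<dim_row a. \<exists>j<dim_col a. a $$ (i, j) \<noteq> {#}) \<and>
     (\<forall>j<dim_col a. \<exists>i<dim_row a. a $$ (i, j) \<noteq> {#})}"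

definition chain0 :: "'d multiset mat \<Rightarrow> 'd multiset mat \<Rightarrow> 'd multiset mat" where
  "chain0 a b = mat (dim_row a + dim_row b) (dim_col a + dim_col b) (\<lambda>(i, j).
     if i < dim_row a \<and> j < dim_col a then a $$ (i, j)
     else if dim_row a \<le> i \<and> dim_col a \<le> j then b $$ (i - dim_row a, j - dim_col a)
     else {#})"

definition chain1 :: "'d multiset mat \<Rightarrow> 'd multiset mat \<Rightarrow> 'd multiset mat" where
  "chain1 a b = mat (dim_row a + dim_row b - 1) (dim_col a + dim_col b) (\<lambda>(i, j).
     if i < dim_row a \<and> j < dim_col a then a $$ (i, j)
     else if dim_row a - 1 \<le> i \<and> dim_col a \<le> j then b $$ (i - (dim_row a - 1), j - dim_col a)
     else {#})"

definition chain2 :: "'d multiset mat \<Rightarrow> 'd multiset mat \<Rightarrow> 'd multiset mat" where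
  "chain2 a b = mat (dim_row a + dim_row b) (dim_col a + dim_col b - 1) (\<lambda>(i, j).
     if i < dim_row a \<and> j < dim_col a then a $$ (i, j)
     else if dim_row a \<le> i \<and> dim_col a - 1 \<le> j then b $$ (i - dim_row a, j - (dim_col a - 1))
     else {#})"

inductive_set chained :: "'d multiset mat set" where
  single: "l \<noteq> {#} \<Longrightarrow> mat 1 1 (\<lambda>_. l) \<in> chained"
| chain0: "a \<in> chained \<Longrightarrow> b \<in> chained \<Longrightarrow> chain0 a b \<in> chained"
| chain1: "a \<in> chained \<Longrightarrow> b \<in> chained \<Longrightarrow> chain1 a b \<in> chained"
| chain2: "a \<in> chained \<Longrightarrow> b \<in> chained \<Longrightarrow> chain2 a b \<in> chained"

section \<open>Eventually zero functions\<close>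

text \<open>
  The index set \<open>\<nat>\<^sup>2\<close> with \<open>\<nat> = {1, 2, \<dots>}\<close> is \<open>{i. (1, 1) \<le> i}\<close> in \<^typ>\<open>nat \<times> nat\<close> with the
  product order. A function on it is represented by its extension by zero to \<^typ>\<open>nat \<times> nat\<close>.
\<close>

definition evZ :: "(nat \<times> nat \<Rightarrow> 'k::zero ^ 'd::finite) set" where
  "evZ = {Z. finite {i. Z i \<noteq> 0} \<and> (\<forall>i. Z i \<noteq> 0 \<longrightarrow> (1, 1) \<le> i)}"

definition ev_size :: "(nat \<times> nat \<Rightarrow> 'k::zero ^ 'd::finite) \<Rightarrow> nat \<times> nat" where
  "ev_size Z = (LEAST n. (1, 1) \<le> n \<and> (\<forall>i. Z i \<noteq> 0 \<longrightarrow> i \<le> n))"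

section \<open>Two-parameter sums signature\<close>

definition monomial_value :: "'k::comm_monoid_mult ^ 'd::finite \<Rightarrow> 'd multiset \<Rightarrow> 'k" where
  "monomial_value z l = (\<Prod>j\<in>#l. vec_nth z j)"

text \<open>
  Increasing sequences \<open>0 < \<iota>\<^sub>1 < \<dots> < \<iota>\<^sub>m\<close> are indexed by \<open>{..<m}\<close>, and are extensional functions so
  that each one is counted once.
\<close>

definition increasing :: "nat \<Rightarrow> (nat \<Rightarrow> nat) set" where
  "increasing m = {\<iota> \<in> {..<m} \<rightarrow>\<^sub>E {1..}. strict_mono_on {..<m} \<iota>}"

definition increasing_upto :: "nat \<Rightarrow> nat \<Rightarrow> (nat \<Rightarrow> nat) set" where
  "increasing_upto m r = {\<iota> \<in> {..<m} \<rightarrow>\<^sub>E {1..r}. strict_mono_on {..<m} \<iota>}"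

definition SS_term ::
  "(nat \<times> nat \<Rightarrow> 'k::comm_semiring_1 ^ 'd::finite) \<Rightarrow> 'd multiset mat \<Rightarrow>
   (nat \<Rightarrow> nat) \<Rightarrow> (nat \<Rightarrow> nat) \<Rightarrow> 'k" where
  "SS_term Z a \<iota> \<kappa> =
     (\<Prod>s<dim_row a. \<Prod>t<dim_col a. monomial_value (Z (\<iota> s, \<kappa> t)) (a $$ (s, t)))"

definition SS_upto ::
  "nat \<times> nat \<Rightarrow> (nat \<times> nat \<Rightarrow> 'k::comm_semiring_1 ^ 'd::finite) \<Rightarrow> 'd multiset mat \<Rightarrow> 'k" where
  "SS_upto r Z a = (\<Sum>(\<iota>, \<kappa>) \<in> increasing_upto (dim_row a) (fst r) \<times> increasing_upto (dim_col a) (snd r).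
     SS_term Z a \<iota> \<kappa>)"

text \<open>
  The sum over all pairs of increasing sequences is infinite, but for a composition and an
  eventually zero function only finitely many summands are non-zero; \<^const>\<open>Sum_any\<close> adds these.
\<close>

definition SS ::
  "(nat \<times> nat \<Rightarrow> 'k::comm_semiring_1 ^ 'd::finite) \<Rightarrow> 'd multiset mat \<Rightarrow> 'k" where
  "SS Z a = Sum_any (\<lambda>(\<iota>, \<kappa>).
     if \<iota> \<in> increasing (dim_row a) \<and> \<kappa> \<in> increasing (dim_col a) then SS_term Z a \<iota> \<kappa> else 0)"

section \<open>Counting arithmetic operations\<close>

text \<open>
  The cost model is that of division-free straight-line programs. A program is a list of operations,
  the \<open>k\<close>-th of which stores its result in register \<open>k\<close> and may read the earlier registers; its cost
  is its length. Access to the input \<open>Z\<close> is only through \<open>Factor i l\<close>, which evaluates \<open>Z\<close> at \<open>i\<close> on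
  the monomial \<open>l\<close>. The only constants are \<open>0\<close> and \<open>1\<close>, and they are counted as well.
\<close>

datatype 'd operation =
    Zero
  | One
  | Factor "nat \<times> nat" "'d multiset"
  | Add nat nat
  | Sub nat nat
  | Mul nat nat

type_synonym 'd program = "'d operation list"

fun result ::
  "(nat \<times> nat \<Rightarrow> 'k::comm_ring_1 ^ 'd::finite) \<Rightarrow> 'k list \<Rightarrow> 'd operation \<Rightarrow> 'k" where
  "result Z regs Zero = 0"
| "result Z regs One = 1"
| "result Z regs (Factor i l) = monomial_value (Z i) l"
| "result Z regs (Add x y) = regs ! x + regs ! y"
| "result Z regs (Sub x y) = regs ! x - regs ! y"
| "result Z regs (Mul x y) = regs ! x * regs ! y"

definition run ::
  "(nat \<times> nat \<Rightarrow> 'k::comm_ring_1 ^ 'd::finite) \<Rightarrow> 'd program \<Rightarrow> 'k list" where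
  "run Z p = foldl (\<lambda>regs f. regs @ [result Z regs f]) [] p"

fun valid_operation :: "nat \<Rightarrow> 'd operation \<Rightarrow> bool" where
  "valid_operation k Zero \<longleftrightarrow> True"
| "valid_operation k One \<longleftrightarrow> True"
| "valid_operation k (Factor i l) \<longleftrightarrow> (1, 1) \<le> i"
| "valid_operation k (Add x y) \<longleftrightarrow> x < k \<and> y < k"
| "valid_operation k (Sub x y) \<longleftrightarrow> x < k \<and> y < k"
| "valid_operation k (Mul x y) \<longleftrightarrow> x < k \<and> y < k"

definition valid_program :: "'d program \<Rightarrow> bool" where
  "valid_program p \<longleftrightarrow> (\<forall>k<length p. valid_operation k (p ! k))"

definition computes ::
  "'d program \<Rightarrow> (nat \<times> nat \<Rightarrow> 'k::comm_ring_1 ^ 'd::finite) \<Rightarrow> nat \<Rightarrow> 'k \<Rightarrow> bool" where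
  "computes p Z k v \<longleftrightarrow> valid_program p \<and> k < length p \<and> run Z p ! k = v"

section \<open>Consistency of the definitions\<close>

lemma chained_dims: "a \<in> chained \<Longrightarrow> 1 \<le> dim_row a \<and> 1 \<le> dim_col a"
  by (induction rule: chained.induct) (auto simp: chain0_def chain1_def chain2_def)

text \<open>Every input has a size, i.e. the \<^const>\<open>Least\<close> in \<^const>\<open>ev_size\<close> exists.\<close>

lemma ev_size_least:
  assumes "Z \<in> evZ"
  shows "(1, 1) \<le> ev_size Z" "Z i \<noteq> 0 \<Longrightarrow> i \<le> ev_size Z"
    and "(1, 1) \<le> n \<Longrightarrow> (\<And>i. Z i \<noteq> 0 \<Longrightarrow> i \<le> n) \<Longrightarrow> ev_size Z \<le> n"
proof -
  let ?S = "insert (1, 1) {i. Z i \<noteq> 0}"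
  let ?m = "(Max (fst ` ?S), Max (snd ` ?S))"
  let ?P = "\<lambda>n. (1, 1) \<le> n \<and> (\<forall>i. Z i \<noteq> 0 \<longrightarrow> i \<le> n)"
  have fin: "finite ?S" using assms by (simp add: evZ_def)
  have P: "?P ?m"
    using fin by (auto simp: less_eq_prod_def intro!: Max_ge)
  have le: "?m \<le> n" if "?P n" for n
  proof -
    have "\<forall>i\<in>?S. i \<le> n" using that by auto
    then have "\<forall>i\<in>?S. fst i \<le> fst n \<and> snd i \<le> snd n" by (simp add: less_eq_prod_def)
    then have "Max (fst ` ?S) \<le> fst n" "Max (snd ` ?S) \<le> snd n"
      using fin by (subst Max_le_iff; blast)+
    then show ?thesis by (simp add: less_eq_prod_def)
  qed
  have eq: "ev_size Z = ?m"
    unfolding ev_size_def by (rule Least_equality) (use P le in auto)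
  show "(1, 1) \<le> ev_size Z" using P eq by simp
  show "Z i \<noteq> 0 \<Longrightarrow> i \<le> ev_size Z" using conjunct2[OF P] unfolding eq by blast
  show "(1, 1) \<le> n \<Longrightarrow> (\<And>i. Z i \<noteq> 0 \<Longrightarrow> i \<le> n) \<Longrightarrow> ev_size Z \<le> n" unfolding eq by (rule le) blast
qed

text \<open>Chained compositions are non-empty compositions.\<close>

lemma chained_subset_compositions: "chained \<subseteq> compositions"
proof
  fix a :: "'d multiset mat" assume "a \<in> chained"
  then show "a \<in> compositions"
  proof induction
    case (single l)
    then show ?case by (auto simp: compositions_def)
  next
    case (chain0 a b)
    have row: "\<exists>j<dim_col a + dim_col b. chain0 a b $$ (i, j) \<noteq> {#}" if i: "i < dim_row a + dim_row b" for i
    proof (cases "i < dim_row a")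
      case True
      then obtain j where "j < dim_col a" "a $$ (i, j) \<noteq> {#}"
        using chain0 by (auto simp: compositions_def)
      then show ?thesis using True by (intro exI[of _ j]) (auto simp: chain0_def)
    next
      case False
      then have "i - dim_row a < dim_row b" using i by simp
      then obtain j where "j < dim_col b" "b $$ (i - dim_row a, j) \<noteq> {#}"
        using chain0 by (auto simp: compositions_def)
      then show ?thesis using False i by (intro exI[of _ "dim_col a + j"]) (auto simp: chain0_def)
    qed
    have col: "\<exists>i<dim_row a + dim_row b. chain0 a b $$ (i, j) \<noteq> {#}" if j: "j < dim_col a + dim_col b" for j
    proof (cases "j < dim_col a")
      case True
      then obtain i where "i < dim_row a" "a $$ (i, j) \<noteq> {#}"
        using chain0 by (auto simp: compositions_def)
      then show ?thesis using True by (intro exI[of _ i]) (auto simp: chain0_def)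
    next
      case False
      then have "j - dim_col a < dim_col b" using j by simp
      then obtain i where "i < dim_row b" "b $$ (i, j - dim_col a) \<noteq> {#}"
        using chain0 by (auto simp: compositions_def)
      then show ?thesis using False j by (intro exI[of _ "dim_row a + i"]) (auto simp: chain0_def)
    qed
    show ?case using chain0 row col by (auto simp: compositions_def chain0_def)
  next
    case (chain1 a b)
    have pos: "1 \<le> dim_row a" "1 \<le> dim_col a" "1 \<le> dim_row b" "1 \<le> dim_col b"
      using chain1 by (auto simp: compositions_def)
    have row: "\<exists>j<dim_col a + dim_col b. chain1 a b $$ (i, j) \<noteq> {#}" if i: "i < dim_row a + dim_row b - 1" for i
    proof (cases "i < dim_row a")
      case True
      then obtain j where "j < dim_col a" "a $$ (i, j) \<noteq> {#}"
        using chain1 by (auto simp: compositions_def)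
      then show ?thesis using True pos by (intro exI[of _ j]) (auto simp: chain1_def)
    next
      case False
      then have "i - (dim_row a - 1) < dim_row b" using i pos by simp
      then obtain j where "j < dim_col b" "b $$ (i - (dim_row a - 1), j) \<noteq> {#}"
        using chain1 by (auto simp: compositions_def)
      then show ?thesis using False i pos by (intro exI[of _ "dim_col a + j"]) (auto simp: chain1_def)
    qed
    have col: "\<exists>i<dim_row a + dim_row b - 1. chain1 a b $$ (i, j) \<noteq> {#}" if j: "j < dim_col a + dim_col b" for j
    proof (cases "j < dim_col a")
      case True
      then obtain i where "i < dim_row a" "a $$ (i, j) \<noteq> {#}"
        using chain1 by (auto simp: compositions_def)
      then show ?thesis using True pos by (intro exI[of _ i]) (auto simp: chain1_def)
    next
      case False
      then have "j - dim_col a < dim_col b" using j by simp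
      then obtain i where "i < dim_row b" "b $$ (i, j - dim_col a) \<noteq> {#}"
        using chain1 by (auto simp: compositions_def)
      then show ?thesis using False j pos by (intro exI[of _ "dim_row a - 1 + i"]) (auto simp: chain1_def)
    qed
    show ?case using pos row col by (auto simp: compositions_def chain1_def)
  next
    case (chain2 a b)
    have pos: "1 \<le> dim_row a" "1 \<le> dim_col a" "1 \<le> dim_row b" "1 \<le> dim_col b"
      using chain2 by (auto simp: compositions_def)
    have row: "\<exists>j<dim_col a + dim_col b - 1. chain2 a b $$ (i, j) \<noteq> {#}" if i: "i < dim_row a + dim_row b" for i
    proof (cases "i < dim_row a")
      case True
      then obtain j where "j < dim_col a" "a $$ (i, j) \<noteq> {#}"
        using chain2 by (auto simp: compositions_def)
      then show ?thesis using True pos by (intro exI[of _ j]) (auto simp: chain2_def)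
    next
      case False
      then have "i - dim_row a < dim_row b" using i by simp
      then obtain j where "j < dim_col b" "b $$ (i - dim_row a, j) \<noteq> {#}"
        using chain2 by (auto simp: compositions_def)
      then show ?thesis using False i pos by (intro exI[of _ "dim_col a - 1 + j"]) (auto simp: chain2_def)
    qed
    have col: "\<exists>i<dim_row a + dim_row b. chain2 a b $$ (i, j) \<noteq> {#}" if j: "j < dim_col a + dim_col b - 1" for j
    proof (cases "j < dim_col a")
      case True
      then obtain i where "i < dim_row a" "a $$ (i, j) \<noteq> {#}"
        using chain2 by (auto simp: compositions_def)
      then show ?thesis using True pos by (intro exI[of _ i]) (auto simp: chain2_def)
    next
      case False
      then have "j - (dim_col a - 1) < dim_col b" using j pos by simp
      then obtain i where "i < dim_row b" "b $$ (i, j - (dim_col a - 1)) \<noteq> {#}"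
        using chain2 by (auto simp: compositions_def)
      then show ?thesis using False j pos by (intro exI[of _ "dim_row a + i"]) (auto simp: chain2_def)
    qed
    show ?case using pos row col by (auto simp: compositions_def chain2_def)
  qed
qed

end

theory Submission
  imports Defs
begin

text \<open>
  The number of pairs of index sequences in the defining sum grows exponentially with the size of the
  composition, but the shape of a chained composition allows for dynamic programming. Write \<open>k\<close> for
  \<open>rows + cols - 1\<close>, and fix a box \<open>N\<close>. A composition \<open>a\<close> acts on functions on the box: its
  \<^emph>\<open>transfer operator\<close> sends a function \<open>G\<close> to the function whose value at \<open>q\<close> is the sum over all
  embeddings of \<open>a\<close> into the box whose last row and last column are placed at \<open>q\<close>, where each
  embedding contributes its product of factors of the input, times the value of \<open>G\<close> at the position
  of the first row and first column. Three facts carry the proof.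

  \<^item> The desired value at \<open>r\<close> is the sum over all \<open>q \<le> r\<close> of the transfer of the constant \<open>1\<close>
  (\<open>SS_upto_eq_sum_transfer\<close>).

  \<^item> The transfer operator of a \<open>1 \<times> 1\<close> composition is pointwise multiplication by a factor of the
  input (\<open>transfer_single\<close>).

  \<^item> An embedding of a chained composition of \<open>a\<close> and \<open>b\<close> is an embedding of \<open>a\<close> followed by one of
  \<open>b\<close>, where the last position of \<open>a\<close> and the first of \<open>b\<close> are strictly ordered in each coordinate,
  or equal in the coordinate that the blocks share. Hence its transfer operator is the composition of
  the two others with an operator in between that sums over rectangles (\<open>transfer_glue\<close>).

  Sums over rectangles anchored at the lower corner, for all points of the box at once, are obtained
  by running partial sums along rows and then along columns, at a constant number of operations per
  point. So every block and every link between blocks costs \<open>O(rows(Z) cols(Z))\<close>, and there are at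
  most \<open>k \<le> rows(a) cols(a)\<close> blocks: each link adds a row or a column. The program only
  depends on \<open>a\<close> and the box, not on the input. Finally, the unbounded sum is the entry at
  \<open>r = size(Z)\<close>: no row and no column of a composition is empty, so that an embedding that leaves the
  box contains a factor \<open>0\<close> (\<open>SS_eq_SS_upto\<close>).
\<close>

section \<open>Straight-line complexity of sets of functions\<close>

type_synonym ('k, 'd) input = "nat \<times> nat \<Rightarrow> 'k ^ 'd"

text \<open>
  Members of \<open>F\<close> are functions of the input, and the quantifier over \<open>Z\<close> stands inside the choice of
  the register: one program serves all inputs. Speaking of sets of functions instead of programs with
  register assignments lets costs be added without tracking where intermediate results are stored.
\<close>

definition computable_within ::
  "nat \<Rightarrow> (('k::comm_ring_1, 'd::finite) input \<Rightarrow> 'k) set \<Rightarrow> bool" where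
  "computable_within n F \<longleftrightarrow> (\<exists>p :: 'd program. length p \<le> n \<and> valid_program p \<and>
     (\<forall>f\<in>F. \<exists>k. \<forall>Z. computes p Z k (f Z)))"

lemma length_run [simp]: "length (run Z p) = length p"
  by (induction p rule: rev_induct) (auto simp: run_def)

lemma run_snoc: "run Z (p @ [x]) = run Z p @ [result Z (run Z p) x]"
  by (simp add: run_def)

lemma valid_program_snoc:
  "valid_program (p @ [x]) \<longleftrightarrow> valid_program p \<and> valid_operation (length p) x"
  by (auto simp: valid_program_def nth_append less_Suc_eq)

lemma computes_snoc_old:
  "computes p Z k v \<Longrightarrow> valid_operation (length p) x \<Longrightarrow> computes (p @ [x]) Z k v"
  by (auto simp: computes_def run_snoc valid_program_snoc nth_append)

lemma computes_snoc_new: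
  "valid_program p \<Longrightarrow> valid_operation (length p) x \<Longrightarrow>
   computes (p @ [x]) Z (length p) (result Z (run Z p) x)"
  by (auto simp: computes_def run_snoc valid_program_snoc nth_append)

lemma computable_within_mono:
  "computable_within n F \<Longrightarrow> n \<le> n' \<Longrightarrow> F' \<subseteq> F \<Longrightarrow> computable_within n' F'"
  unfolding computable_within_def by (meson order_trans subset_iff)

lemma computable_within_empty: "computable_within 0 {}"
  by (auto simp: computable_within_def valid_program_def)

lemma computable_within_snoc:
  assumes "length p \<le> n" "valid_program p" "\<forall>f\<in>F. \<exists>k. \<forall>Z. computes p Z k (f Z)"
    and "valid_operation (length p) x" "\<And>Z. result Z (run Z p) x = g Z"
  shows "computable_within (Suc n) (insert g F)"
  unfolding computable_within_def
proof (intro exI[of _ "p @ [x]"] conjI ballI)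
  fix f assume "f \<in> insert g F"
  then consider "f = g" | "f \<in> F" by blast
  then show "\<exists>k. \<forall>Z. computes (p @ [x]) Z k (f Z)"
  proof cases
    case 1
    then show ?thesis using computes_snoc_new[OF assms(2,4)] assms(5) by metis
  next
    case 2
    then show ?thesis using assms(3,4) computes_snoc_old by blast
  qed
qed (use assms in \<open>auto simp: valid_program_snoc\<close>)

lemma computable_within_zero:
  "computable_within n F \<Longrightarrow> computable_within (Suc n) (insert (\<lambda>Z. 0) F)"
  by (auto simp: computable_within_def[of n] intro: computable_within_snoc[where x = Zero])

lemma computable_within_one:
  "computable_within n F \<Longrightarrow> computable_within (Suc n) (insert (\<lambda>Z. 1) F)"
  by (auto simp: computable_within_def[of n] intro: computable_within_snoc[where x = One])

lemma computable_within_factor: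
  "computable_within n F \<Longrightarrow> (1, 1) \<le> i \<Longrightarrow>
   computable_within (Suc n) (insert (\<lambda>Z. monomial_value (Z i) l) F)"
  by (auto simp: computable_within_def[of n] intro: computable_within_snoc[where x = "Factor i l"])

lemma computable_within_add:
  assumes "computable_within n F" "f \<in> F" "g \<in> F"
  shows "computable_within (Suc n) (insert (\<lambda>Z. f Z + g Z) F)"
proof -
  obtain p where p: "length p \<le> n" "valid_program p" "\<forall>f\<in>F. \<exists>k. \<forall>Z. computes p Z k (f Z)"
    using assms(1) by (auto simp: computable_within_def)
  obtain x y where "\<forall>Z. computes p Z x (f Z)" "\<forall>Z. computes p Z y (g Z)"
    using p(3) assms(2,3) by meson
  then show ?thesis
    by (intro computable_within_snoc[OF p, of "Add x y"]) (auto simp: computes_def)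
qed

lemma computable_within_mult:
  assumes "computable_within n F" "f \<in> F" "g \<in> F"
  shows "computable_within (Suc n) (insert (\<lambda>Z. f Z * g Z) F)"
proof -
  obtain p where p: "length p \<le> n" "valid_program p" "\<forall>f\<in>F. \<exists>k. \<forall>Z. computes p Z k (f Z)"
    using assms(1) by (auto simp: computable_within_def)
  obtain x y where "\<forall>Z. computes p Z x (f Z)" "\<forall>Z. computes p Z y (g Z)"
    using p(3) assms(2,3) by meson
  then show ?thesis
    by (intro computable_within_snoc[OF p, of "Mul x y"]) (auto simp: computes_def)
qed

text \<open>
  The hypothesis is about every superset \<open>F'\<close> of \<open>F\<close>, because the results for the other members of
  \<open>A\<close> are already present when \<open>H x\<close> is computed.
\<close>

lemma computable_within_family:
  assumes "finite A" "computable_within n F"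
    and step: "\<And>x m F'. x \<in> A \<Longrightarrow> F \<subseteq> F' \<Longrightarrow> computable_within m F' \<Longrightarrow>
      computable_within (m + c) (H x \<union> F')"
  shows "computable_within (n + card A * c) ((\<Union>x\<in>A. H x) \<union> F)"
proof -
  have "computable_within (n + card B * c) ((\<Union>x\<in>B. H x) \<union> F)" if "B \<subseteq> A" for B
    using finite_subset[OF that \<open>finite A\<close>] that
  proof (induction B)
    case empty
    then show ?case using assms(2) by simp
  next
    case (insert x B)
    then have "computable_within (n + card B * c + c) (H x \<union> ((\<Union>x\<in>B. H x) \<union> F))"
      by (intro step) auto
    then show ?case using insert by (simp add: Un_assoc algebra_simps)
  qed
  then show ?thesis by simp
qed

text \<open>
  Each partial sum is obtained from the one before by a single addition; this reuse is the source of
  the linear running time.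
\<close>

lemma computable_within_partial_sums:
  assumes "computable_within m F" "\<And>j. j \<in> {1..n} \<Longrightarrow> g j \<in> F"
  shows "computable_within (m + Suc n) ((\<lambda>k Z. \<Sum>j\<in>{1..k}. g j Z) ` {..n} \<union> F)"
  using assms(2)
proof (induction n)
  case 0
  then show ?case using computable_within_zero[OF assms(1)] by simp
next
  case (Suc n)
  let ?s = "\<lambda>k Z. \<Sum>j\<in>{1..k}. g j Z"
  have "computable_within (m + Suc n) (?s ` {..n} \<union> F)" using Suc by simp
  then have "computable_within (Suc (m + Suc n))
      (insert (\<lambda>Z. ?s n Z + g (Suc n) Z) (?s ` {..n} \<union> F))"
    by (rule computable_within_add) (use Suc.prems in auto)
  then show ?case by (simp add: atMost_Suc)
qed

lemma computable_within_partial_sums_family: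
  assumes "finite A" "computable_within m F" "\<And>x j. x \<in> A \<Longrightarrow> j \<in> {1..n} \<Longrightarrow> g x j \<in> F"
    and "1 \<le> n"
  shows "computable_within (m + 2 * card A * n)
    ((\<Union>x\<in>A. (\<lambda>k Z. \<Sum>j\<in>{1..k}. g x j Z) ` {..n}) \<union> F)"
proof (rule computable_within_mono[OF computable_within_family[OF assms(1,2), where c = "Suc n"]])
  show "computable_within (l + Suc n) ((\<lambda>k Z. \<Sum>j\<in>{1..k}. g x j Z) ` {..n} \<union> F')"
    if "x \<in> A" "F \<subseteq> F'" "computable_within l F'" for x l F'
    using that assms(3) by (intro computable_within_partial_sums) auto
  \<comment> \<open>The empty sum is one more value per line; the factor 2 absorbs it.\<close>
  have "Suc n \<le> 2 * n" using \<open>1 \<le> n\<close> by simp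
  then have "card A * Suc n \<le> card A * (2 * n)" by (rule mult_le_mono2)
  then show "m + card A * Suc n \<le> m + 2 * card A * n" by (simp add: ac_simps)
qed auto

section \<open>Increasing sequences that are cut in two\<close>

text \<open>
  The admissible last indices of a first sequence when the second one starts at \<open>v\<close>: below \<open>v\<close> if the
  two share no index, and \<open>v\<close> itself if they share one. In general \<open>d\<close> is the number of shared
  indices, \<open>0\<close> or \<open>1\<close>.
\<close>

definition before :: "nat \<Rightarrow> nat \<Rightarrow> nat set" where
  "before d v = (if d = 0 then {1..<v} else {v})"

lemma finite_before [simp]: "finite (before d v)"
  by (simp add: before_def)

lemma finite_increasing_upto [simp]: "finite (increasing_upto m n)"
  unfolding increasing_upto_def
  by (rule finite_subset[of _ "{..<m} \<rightarrow>\<^sub>E {1..n}"]) (auto intro: finite_PiE)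

lemma increasing_upto_le:
  "\<iota> \<in> increasing_upto m n \<Longrightarrow> i \<le> j \<Longrightarrow> j < m \<Longrightarrow> \<iota> i \<le> \<iota> j"
  unfolding increasing_upto_def strict_mono_on_def
  by (cases "i = j") (auto simp: less_imp_le)

lemma increasing_upto_range:
  "\<iota> \<in> increasing_upto m n \<Longrightarrow> i < m \<Longrightarrow> 1 \<le> \<iota> i \<and> \<iota> i \<le> n"
  unfolding increasing_upto_def by fastforce

text \<open>
  An increasing sequence of length \<open>m1 + m2 - d\<close> is the same as its first \<open>m1\<close> entries together with
  its last \<open>m2\<close> entries, and two increasing sequences arise in this way if and only if they are
  compatible at the cut. This is used separately for the row and the column indices.
\<close>

lemma sum_increasing_upto_cut:
  fixes f :: "(nat \<Rightarrow> nat) \<Rightarrow> (nat \<Rightarrow> nat) \<Rightarrow> 'k::comm_semiring_1"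
  assumes "1 \<le> m1" "1 \<le> m2" "d \<le> 1"
  shows "(\<Sum>\<iota>\<in>increasing_upto (m1 + m2 - d) n.
        f (restrict \<iota> {..<m1}) (restrict (\<lambda>s. \<iota> (s + (m1 - d))) {..<m2})) =
      (\<Sum>\<iota>1\<in>increasing_upto m1 n. \<Sum>\<iota>2\<in>increasing_upto m2 n.
        of_bool (\<iota>1 (m1 - 1) \<in> before d (\<iota>2 0)) * f \<iota>1 \<iota>2)"
    (is "?L = ?R")
proof -
  let ?P = "{(\<iota>1, \<iota>2) \<in> increasing_upto m1 n \<times> increasing_upto m2 n. \<iota>1 (m1 - 1) \<in> before d (\<iota>2 0)}"
  let ?cut = "\<lambda>\<iota>. (restrict \<iota> {..<m1}, restrict (\<lambda>s. \<iota> (s + (m1 - d))) {..<m2})"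
  let ?glue = "\<lambda>(\<iota>1, \<iota>2). restrict (\<lambda>s. if s < m1 then \<iota>1 s else \<iota>2 (s - (m1 - d))) {..<m1 + m2 - d}"
  have "?L = (\<Sum>(\<iota>1, \<iota>2)\<in>?P. f \<iota>1 \<iota>2)"
  proof (rule sum.reindex_bij_witness[where i = ?glue and j = ?cut])
    fix \<iota> assume \<iota>: "\<iota> \<in> increasing_upto (m1 + m2 - d) n"
    then have ext: "\<iota> s = undefined" if "\<not> s < m1 + m2 - d" for s
      using that by (auto simp: increasing_upto_def PiE_def extensional_def)
    have ran: "1 \<le> \<iota> s \<and> \<iota> s \<le> n" if "s < m1 + m2 - d" for s
      using increasing_upto_range[OF \<iota> that] .
    have mono: "\<iota> s < \<iota> t" if "s < t" "t < m1 + m2 - d" for s t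
      using \<iota> that by (auto simp: increasing_upto_def strict_mono_on_def)
    show "?glue (?cut \<iota>) = \<iota>"
      using assms ext by (auto simp: fun_eq_iff)
    show "?cut \<iota> \<in> ?P"
      using assms ran mono
      by (auto simp: increasing_upto_def strict_mono_on_def before_def le_Suc_eq)
  next
    fix x assume "x \<in> ?P"
    then obtain \<iota>1 \<iota>2 where x: "x = (\<iota>1, \<iota>2)"
      and i1: "\<iota>1 \<in> increasing_upto m1 n" and i2: "\<iota>2 \<in> increasing_upto m2 n"
      and m: "\<iota>1 (m1 - 1) \<in> before d (\<iota>2 0)" by auto
    have mono1: "\<iota>1 s < \<iota>1 t" if "s < t" "t < m1" for s t
      using i1 that by (auto simp: increasing_upto_def strict_mono_on_def)
    have mono2: "\<iota>2 s < \<iota>2 t" if "s < t" "t < m2" for s t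
      using i2 that by (auto simp: increasing_upto_def strict_mono_on_def)
    \<comment> \<open>Monotonicity of the joined sequence across the cut; if an index is shared, then the
      strict inequality comes from the second sequence.\<close>
    have across: "\<iota>1 s < \<iota>2 (t - (m1 - d))" if "s < m1" "m1 \<le> t" "t < m1 + m2 - d" for s t
    proof -
      have a: "\<iota>1 s \<le> \<iota>1 (m1 - 1)" using increasing_upto_le[OF i1, of s "m1 - 1"] that by simp
      show ?thesis
      proof (cases "d = 0")
        case True
        then have "\<iota>1 (m1 - 1) < \<iota>2 0" using m by (simp add: before_def)
        moreover have "\<iota>2 0 \<le> \<iota>2 (t - (m1 - d))" using increasing_upto_le[OF i2] that assms by simp
        ultimately show ?thesis using a by linarith
      next
        case False
        then have "\<iota>1 (m1 - 1) = \<iota>2 0" using m by (simp add: before_def)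
        moreover have "\<iota>2 0 < \<iota>2 (t - (m1 - d))"
          using that assms False by (intro mono2) auto
        ultimately show ?thesis using a by linarith
      qed
    qed
    have ext: "\<iota>1 s = undefined" if "\<not> s < m1" for s
      using i1 that by (auto simp: increasing_upto_def PiE_def extensional_def)
    have ext2: "\<iota>2 s = undefined" if "\<not> s < m2" for s
      using i2 that by (auto simp: increasing_upto_def PiE_def extensional_def)
    have "?glue x s < ?glue x t" if "s < t" "t < m1 + m2 - d" for s t
      using that assms mono1[of s t] mono2[of "s - (m1 - d)" "t - (m1 - d)"] across[of s t]
      by (auto simp: x)
    moreover have "?glue x s \<in> {1..n}" if "s < m1 + m2 - d" for s
      using that assms increasing_upto_range[OF i1, of s] increasing_upto_range[OF i2, of "s - (m1 - d)"]
      by (auto simp: x)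
    ultimately show "?glue x \<in> increasing_upto (m1 + m2 - d) n"
      by (auto simp: increasing_upto_def strict_mono_on_def PiE_def x)
    have "\<iota>1 (m1 - d) = \<iota>2 0" if "d = 1" using m that by (simp add: before_def)
    then have "?glue x (s + (m1 - d)) = \<iota>2 s" if "s < m2" for s
      using assms that by (cases "d = 0"; cases "s = 0") (auto simp: x le_Suc_eq)
    then have "restrict (\<lambda>s. ?glue x (s + (m1 - d))) {..<m2} = \<iota>2"
      using ext2 by (auto simp: fun_eq_iff)
    moreover have "restrict (?glue x) {..<m1} = \<iota>1"
      using assms ext by (auto simp: x fun_eq_iff)
    ultimately show "?cut (?glue x) = x" by (simp add: x)
  qed simp
  also have "\<dots> = ?R"
    unfolding sum.cartesian_product
    by (intro sum.mono_neutral_cong_left) (auto simp: of_bool_def split: if_splits)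
  finally show ?thesis .
qed

section \<open>Gluing compositions along shared rows or columns\<close>

text \<open>
  The three chaining operations differ only in the number \<open>d\<close> of rows and \<open>e\<close> of columns that the
  two blocks share.
\<close>

definition glue :: "nat \<Rightarrow> nat \<Rightarrow> 'd multiset mat \<Rightarrow> 'd multiset mat \<Rightarrow> 'd multiset mat" where
  "glue d e a b = mat (dim_row a + dim_row b - d) (dim_col a + dim_col b - e) (\<lambda>(i, j).
     if i < dim_row a \<and> j < dim_col a then a $$ (i, j)
     else if dim_row a - d \<le> i \<and> dim_col a - e \<le> j
       then b $$ (i - (dim_row a - d), j - (dim_col a - e))
     else {#})"

lemma chain_glue: "chain0 a b = glue 0 0 a b" "chain1 a b = glue 1 0 a b" "chain2 a b = glue 0 1 a b"
  by (simp_all only: glue_def chain0_def chain1_def chain2_def diff_zero)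

lemma dim_glue [simp]:
  "dim_row (glue d e a b) = dim_row a + dim_row b - d"
  "dim_col (glue d e a b) = dim_col a + dim_col b - e"
  by (simp_all add: glue_def)

lemma monomial_value_empty [simp]: "monomial_value z {#} = 1"
  by (simp add: monomial_value_def)

text \<open>
  Outside of the two blocks the entries are neutral and contribute the factor \<open>1\<close>. The blocks
  themselves are disjoint, because at most one of a row and a column is shared.
\<close>

lemma SS_term_glue:
  fixes Z :: "nat \<times> nat \<Rightarrow> 'k::comm_semiring_1 ^ 'd::finite"
  assumes "1 \<le> dim_row a" "1 \<le> dim_col a" "1 \<le> dim_row b" "1 \<le> dim_col b" "d + e \<le> 1"
  shows "SS_term Z (glue d e a b) \<iota> \<kappa> =
    SS_term Z a \<iota> \<kappa> *
    SS_term Z b (\<lambda>s. \<iota> (s + (dim_row a - d))) (\<lambda>t. \<kappa> (t + (dim_col a - e)))"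
proof -
  let ?m = "dim_row a - d" and ?n = "dim_col a - e"
  let ?S = "{..<dim_row a + dim_row b - d} \<times> {..<dim_col a + dim_col b - e}"
  let ?A = "{..<dim_row a} \<times> {..<dim_col a}"
  let ?B0 = "{..<dim_row b} \<times> {..<dim_col b}"
  let ?sh = "\<lambda>(s, t). (s + ?m, t + ?n)"
  let ?v = "\<lambda>c (s, t). monomial_value (Z (\<iota> s, \<kappa> t)) (c $$ (s, t))"
  have SS_prod: "SS_term Z c \<iota>' \<kappa>' = (\<Prod>(s, t)\<in>{..<dim_row c} \<times> {..<dim_col c}.
      monomial_value (Z (\<iota>' s, \<kappa>' t)) (c $$ (s, t)))" for c :: "'d multiset mat" and \<iota>' \<kappa>'
    by (simp add: SS_term_def prod.cartesian_product)
  have B: "(s, t) \<in> ?sh ` ?B0" if "(s, t) \<in> ?S" "?m \<le> s" "?n \<le> t" for s t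
    using that assms by (intro image_eqI[of _ _ "(s - ?m, t - ?n)"]) auto
  \<comment> \<open>Here d + e \<le> 1 is essential: with a row and a column shared, the last entry of a and the
    first entry of b would collide.\<close>
  have disj: "?A \<inter> ?sh ` ?B0 = {}" using assms(5) by auto
  have "SS_term Z (glue d e a b) \<iota> \<kappa> = prod (?v (glue d e a b)) ?S"
    by (simp add: SS_prod)
  also have "\<dots> = prod (?v (glue d e a b)) (?A \<union> ?sh ` ?B0)"
  proof (rule prod.mono_neutral_right)
    show "?A \<union> ?sh ` ?B0 \<subseteq> ?S"
      using assms by auto
    show "\<forall>x\<in>?S - (?A \<union> ?sh ` ?B0). ?v (glue d e a b) x = 1"
    proof
      fix x assume x: "x \<in> ?S - (?A \<union> ?sh ` ?B0)"
      obtain s t where st: "x = (s, t)" by force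
      have "\<not> (?m \<le> s \<and> ?n \<le> t)" using x B[of s t] st by blast
      then show "?v (glue d e a b) x = 1" using x by (auto simp: st glue_def)
    qed
  qed simp
  also have "\<dots> = prod (?v (glue d e a b)) ?A * prod (?v (glue d e a b)) (?sh ` ?B0)"
    using disj by (intro prod.union_disjoint) auto
  also have "prod (?v (glue d e a b)) ?A = SS_term Z a \<iota> \<kappa>"
    unfolding SS_prod by (rule prod.cong) (use assms in \<open>auto simp: glue_def\<close>)
  also have "prod (?v (glue d e a b)) (?sh ` ?B0) = prod (?v (glue d e a b) \<circ> ?sh) ?B0"
    by (rule prod.reindex) (auto simp: inj_on_def)
  also have "\<dots> = SS_term Z b (\<lambda>s. \<iota> (s + ?m)) (\<lambda>t. \<kappa> (t + ?n))"
    unfolding SS_prod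
  proof (rule prod.cong)
    fix x assume x: "x \<in> ?B0"
    obtain s t where st: "x = (s, t)" by force
    have "\<not> (s + ?m < dim_row a \<and> t + ?n < dim_col a)" using assms(5) by auto
    then show "(?v (glue d e a b) \<circ> ?sh) x = (case x of (s, t) \<Rightarrow>
        monomial_value (Z (\<iota> (s + ?m), \<kappa> (t + ?n))) (b $$ (s, t)))"
      using x assms by (auto simp: st glue_def)
  qed simp
  finally show ?thesis .
qed

lemma SS_term_cong:
  assumes "\<And>s. s < dim_row a \<Longrightarrow> \<iota> s = \<iota>' s" "\<And>t. t < dim_col a \<Longrightarrow> \<kappa> t = \<kappa>' t"
  shows "SS_term Z a \<iota> \<kappa> = SS_term Z a \<iota>' \<kappa>'"
  unfolding SS_term_def using assms by (intro prod.cong) auto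

section \<open>Transfer operators\<close>

text \<open>
  The condition on the end point is written as a factor, so that all sums range over fixed sets and can
  be interchanged freely.
\<close>

definition transfer ::
  "nat \<times> nat \<Rightarrow> (nat \<times> nat \<Rightarrow> 'k::comm_semiring_1 ^ 'd::finite) \<Rightarrow> 'd multiset mat \<Rightarrow>
   (nat \<times> nat \<Rightarrow> 'k) \<Rightarrow> nat \<times> nat \<Rightarrow> 'k" where
  "transfer N Z a G q =
     (\<Sum>\<iota>\<in>increasing_upto (dim_row a) (fst N). \<Sum>\<kappa>\<in>increasing_upto (dim_col a) (snd N).
        of_bool (\<iota> (dim_row a - 1) = fst q \<and> \<kappa> (dim_col a - 1) = snd q) *
        (G (\<iota> 0, \<kappa> 0) * SS_term Z a \<iota> \<kappa>))"

text \<open>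
  The operator that links two blocks: from the end points of the first one to the starting point \<open>v\<close>
  of the second.
\<close>

definition step ::
  "nat \<Rightarrow> nat \<Rightarrow> (nat \<times> nat \<Rightarrow> 'k::comm_semiring_1) \<Rightarrow> nat \<times> nat \<Rightarrow> 'k" where
  "step d e G v = (\<Sum>i\<in>before d (fst v). \<Sum>j\<in>before e (snd v). G (i, j))"

lemma of_bool_conj_mult: "of_bool (P \<and> Q) = (of_bool P * of_bool Q :: 'k::comm_semiring_1)"
  by simp

text \<open>
  Summing over the end points removes the condition on where an embedding ends, or relaxes it to
  membership in a rectangle.
\<close>

lemma sum_transfer:
  assumes "finite I" "finite J"
  shows "(\<Sum>i\<in>I. \<Sum>j\<in>J. transfer N Z a G (i, j)) =
     (\<Sum>\<iota>\<in>increasing_upto (dim_row a) (fst N). \<Sum>\<kappa>\<in>increasing_upto (dim_col a) (snd N).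
        of_bool (\<iota> (dim_row a - 1) \<in> I \<and> \<kappa> (dim_col a - 1) \<in> J) *
        (G (\<iota> 0, \<kappa> 0) * SS_term Z a \<iota> \<kappa>))"
proof -
  have delta: "(\<Sum>i\<in>I. \<Sum>j\<in>J. of_bool (x = i \<and> y = j) * c) = of_bool (x \<in> I \<and> y \<in> J) * c"
    for x y and c :: 'a
  proof -
    have "(\<Sum>i\<in>I. \<Sum>j\<in>J. of_bool (x = i \<and> y = j) * c) =
        (\<Sum>p\<in>I \<times> J. if p = (x, y) then c else 0)"
      unfolding sum.cartesian_product
    proof (rule sum.cong)
      fix p assume "p \<in> I \<times> J"
      show "(case p of (i, j) \<Rightarrow> of_bool (x = i \<and> y = j) * c) = (if p = (x, y) then c else 0)"
        by (cases p; cases "p = (x, y)") auto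
    qed simp
    also have "\<dots> = of_bool (x \<in> I \<and> y \<in> J) * c"
      using assms by (simp add: sum.delta)
    finally show ?thesis .
  qed
  have "(\<Sum>i\<in>I. \<Sum>j\<in>J. transfer N Z a G (i, j)) =
     (\<Sum>\<iota>\<in>increasing_upto (dim_row a) (fst N). \<Sum>\<kappa>\<in>increasing_upto (dim_col a) (snd N).
        \<Sum>i\<in>I. \<Sum>j\<in>J. of_bool (\<iota> (dim_row a - 1) = i \<and> \<kappa> (dim_col a - 1) = j) *
        (G (\<iota> 0, \<kappa> 0) * SS_term Z a \<iota> \<kappa>))" (is "_ = ?X")
  proof -
    have "?X = (\<Sum>\<iota>\<in>increasing_upto (dim_row a) (fst N). \<Sum>i\<in>I. \<Sum>\<kappa>\<in>increasing_upto (dim_col a) (snd N).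
        \<Sum>j\<in>J. of_bool (\<iota> (dim_row a - 1) = i \<and> \<kappa> (dim_col a - 1) = j) *
        (G (\<iota> 0, \<kappa> 0) * SS_term Z a \<iota> \<kappa>))"
      by (intro sum.cong refl sum.swap)
    also have "\<dots> = (\<Sum>i\<in>I. \<Sum>\<iota>\<in>increasing_upto (dim_row a) (fst N). \<Sum>\<kappa>\<in>increasing_upto (dim_col a) (snd N).
        \<Sum>j\<in>J. of_bool (\<iota> (dim_row a - 1) = i \<and> \<kappa> (dim_col a - 1) = j) *
        (G (\<iota> 0, \<kappa> 0) * SS_term Z a \<iota> \<kappa>))"
      by (rule sum.swap)
    also have "\<dots> = (\<Sum>i\<in>I. \<Sum>\<iota>\<in>increasing_upto (dim_row a) (fst N). \<Sum>j\<in>J. \<Sum>\<kappa>\<in>increasing_upto (dim_col a) (snd N).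
        of_bool (\<iota> (dim_row a - 1) = i \<and> \<kappa> (dim_col a - 1) = j) *
        (G (\<iota> 0, \<kappa> 0) * SS_term Z a \<iota> \<kappa>))"
      by (intro sum.cong refl sum.swap)
    also have "\<dots> = (\<Sum>i\<in>I. \<Sum>j\<in>J. transfer N Z a G (i, j))"
      unfolding transfer_def fst_conv snd_conv by (intro sum.cong refl sum.swap)
    finally show ?thesis by simp
  qed
  also have "\<dots> = (\<Sum>\<iota>\<in>increasing_upto (dim_row a) (fst N). \<Sum>\<kappa>\<in>increasing_upto (dim_col a) (snd N).
        of_bool (\<iota> (dim_row a - 1) \<in> I \<and> \<kappa> (dim_col a - 1) \<in> J) *
        (G (\<iota> 0, \<kappa> 0) * SS_term Z a \<iota> \<kappa>))"
    unfolding delta ..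
  finally show ?thesis .
qed

text \<open>
  The central identity. Row and column sequences are cut independently, the product over the entries
  splits accordingly, and the compatibility conditions at the two cuts say that the end point of \<open>a\<close>
  lies in the rectangle over which \<^const>\<open>step\<close> sums at the starting point of \<open>b\<close>.
\<close>

lemma transfer_glue:
  fixes Z :: "nat \<times> nat \<Rightarrow> 'k::comm_semiring_1 ^ 'd::finite"
  assumes a: "1 \<le> dim_row a" "1 \<le> dim_col a" and b: "1 \<le> dim_row b" "1 \<le> dim_col b"
    and de: "d + e \<le> 1"
  shows "transfer N Z (glue d e a b) G q = transfer N Z b (step d e (transfer N Z a G)) q"
proof -
  let ?Ra = "increasing_upto (dim_row a) (fst N)" and ?Ca = "increasing_upto (dim_col a) (snd N)"
  let ?Rb = "increasing_upto (dim_row b) (fst N)" and ?Cb = "increasing_upto (dim_col b) (snd N)"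
  let ?end = "\<lambda>\<iota> \<kappa>. of_bool (\<iota> (dim_row b - 1) = fst q \<and> \<kappa> (dim_col b - 1) = snd q) :: 'k"
  let ?f = "\<lambda>\<iota>1 \<iota>2 \<kappa>1 \<kappa>2. ?end \<iota>2 \<kappa>2 *
    (G (\<iota>1 0, \<kappa>1 0) * (SS_term Z a \<iota>1 \<kappa>1 * SS_term Z b \<iota>2 \<kappa>2))"
  let ?meet = "\<lambda>d m \<iota>1 \<iota>2. of_bool (\<iota>1 (m - 1) \<in> before d (\<iota>2 0)) :: 'k"
  have le: "d \<le> 1" "e \<le> 1" using de by auto
  have summand: "of_bool (\<iota> (dim_row (glue d e a b) - 1) = fst q \<and> \<kappa> (dim_col (glue d e a b) - 1) = snd q) *
        (G (\<iota> 0, \<kappa> 0) * SS_term Z (glue d e a b) \<iota> \<kappa>) =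
      ?f (restrict \<iota> {..<dim_row a}) (restrict (\<lambda>s. \<iota> (s + (dim_row a - d))) {..<dim_row b})
         (restrict \<kappa> {..<dim_col a}) (restrict (\<lambda>t. \<kappa> (t + (dim_col a - e))) {..<dim_col b})" for \<iota> \<kappa>
  proof -
    have "dim_row b - 1 + (dim_row a - d) = dim_row (glue d e a b) - 1"
      "dim_col b - 1 + (dim_col a - e) = dim_col (glue d e a b) - 1"
      using a b le by auto
    moreover have "SS_term Z a (restrict \<iota> {..<dim_row a}) (restrict \<kappa> {..<dim_col a}) = SS_term Z a \<iota> \<kappa>"
      by (rule SS_term_cong) auto
    moreover have "SS_term Z b (restrict (\<lambda>s. \<iota> (s + (dim_row a - d))) {..<dim_row b})
          (restrict (\<lambda>t. \<kappa> (t + (dim_col a - e))) {..<dim_col b}) =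
        SS_term Z b (\<lambda>s. \<iota> (s + (dim_row a - d))) (\<lambda>t. \<kappa> (t + (dim_col a - e)))"
      by (rule SS_term_cong) auto
    ultimately show ?thesis
      using a b by (simp add: SS_term_glue[OF a b de] del: dim_glue)
  qed
  let ?head = "\<lambda>\<iota>. restrict \<iota> {..<dim_row a}"
  let ?tail = "\<lambda>\<iota>. restrict (\<lambda>s. \<iota> (s + (dim_row a - d))) {..<dim_row b}"
  have cols: "(\<Sum>\<kappa>\<in>increasing_upto (dim_col a + dim_col b - e) (snd N). ?f \<iota>1 \<iota>2
        (restrict \<kappa> {..<dim_col a}) (restrict (\<lambda>t. \<kappa> (t + (dim_col a - e))) {..<dim_col b})) =
      (\<Sum>\<kappa>1\<in>?Ca. \<Sum>\<kappa>2\<in>?Cb. ?meet e (dim_col a) \<kappa>1 \<kappa>2 * ?f \<iota>1 \<iota>2 \<kappa>1 \<kappa>2)" for \<iota>1 \<iota>2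
    by (rule sum_increasing_upto_cut[OF a(2) b(2) le(2), where f = "?f \<iota>1 \<iota>2"])
  have "transfer N Z (glue d e a b) G q =
      (\<Sum>\<iota>\<in>increasing_upto (dim_row a + dim_row b - d) (fst N).
        \<Sum>\<kappa>1\<in>?Ca. \<Sum>\<kappa>2\<in>?Cb. ?meet e (dim_col a) \<kappa>1 \<kappa>2 * ?f (?head \<iota>) (?tail \<iota>) \<kappa>1 \<kappa>2)"
    unfolding transfer_def summand unfolding dim_glue cols ..
  also have "\<dots> = (\<Sum>\<iota>1\<in>?Ra. \<Sum>\<iota>2\<in>?Rb. ?meet d (dim_row a) \<iota>1 \<iota>2 *
        (\<Sum>\<kappa>1\<in>?Ca. \<Sum>\<kappa>2\<in>?Cb. ?meet e (dim_col a) \<kappa>1 \<kappa>2 * ?f \<iota>1 \<iota>2 \<kappa>1 \<kappa>2))"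
    by (rule sum_increasing_upto_cut[OF a(1) b(1) le(1), where f = "\<lambda>\<iota>1 \<iota>2.
        \<Sum>\<kappa>1\<in>?Ca. \<Sum>\<kappa>2\<in>?Cb. ?meet e (dim_col a) \<kappa>1 \<kappa>2 * ?f \<iota>1 \<iota>2 \<kappa>1 \<kappa>2"])
  also have "\<dots> = (\<Sum>\<iota>2\<in>?Rb. \<Sum>\<iota>1\<in>?Ra. \<Sum>\<kappa>2\<in>?Cb. \<Sum>\<kappa>1\<in>?Ca.
      ?meet d (dim_row a) \<iota>1 \<iota>2 * (?meet e (dim_col a) \<kappa>1 \<kappa>2 * ?f \<iota>1 \<iota>2 \<kappa>1 \<kappa>2))"
    unfolding sum_distrib_left
    by (subst sum.swap) (intro sum.cong refl sum.swap)
  also have "\<dots> = (\<Sum>\<iota>2\<in>?Rb. \<Sum>\<kappa>2\<in>?Cb. \<Sum>\<iota>1\<in>?Ra. \<Sum>\<kappa>1\<in>?Ca.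
      ?meet d (dim_row a) \<iota>1 \<iota>2 * (?meet e (dim_col a) \<kappa>1 \<kappa>2 * ?f \<iota>1 \<iota>2 \<kappa>1 \<kappa>2))"
    by (intro sum.cong refl sum.swap)
  also have "\<dots> = transfer N Z b (step d e (transfer N Z a G)) q"
    unfolding transfer_def[of N Z b] step_def fst_conv snd_conv sum_transfer[OF finite_before finite_before]
    by (intro sum.cong refl)
      (simp add: sum_distrib_left sum_distrib_right of_bool_conj_mult ac_simps del: of_bool_conj)
  finally show ?thesis .
qed

text \<open>
  An increasing sequence is bounded by its last entry.
\<close>

lemma increasing_upto_restrict:
  assumes "1 \<le> m" "r \<le> n"
  shows "increasing_upto m r = {\<iota> \<in> increasing_upto m n. \<iota> (m - 1) \<in> {1..r}}"
proof (intro subset_antisym subsetI)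
  fix \<iota> assume \<iota>: "\<iota> \<in> increasing_upto m r"
  then have "\<iota> (m - 1) \<in> {1..r}" using increasing_upto_range[OF \<iota>, of "m - 1"] assms by simp
  moreover have "\<iota> \<in> increasing_upto m n" using \<iota> assms(2) by (fastforce simp: increasing_upto_def)
  ultimately show "\<iota> \<in> {\<iota> \<in> increasing_upto m n. \<iota> (m - 1) \<in> {1..r}}" by simp
next
  fix \<iota> assume "\<iota> \<in> {\<iota> \<in> increasing_upto m n. \<iota> (m - 1) \<in> {1..r}}"
  then have \<iota>: "\<iota> \<in> increasing_upto m n" and le: "\<iota> (m - 1) \<le> r" by auto
  have "\<iota> i \<in> {1..r}" if "i < m" for i
    using increasing_upto_le[OF \<iota>, of i "m - 1"] increasing_upto_range[OF \<iota> that] that le by fastforce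
  then show "\<iota> \<in> increasing_upto m r" using \<iota> by (auto simp: increasing_upto_def PiE_def)
qed

lemma SS_upto_eq_sum_transfer:
  assumes "1 \<le> dim_row a" "1 \<le> dim_col a" "r \<le> N"
  shows "SS_upto r Z a = (\<Sum>i\<in>{1..fst r}. \<Sum>j\<in>{1..snd r}. transfer N Z a (\<lambda>_. 1) (i, j))"
proof -
  have "fst r \<le> fst N" "snd r \<le> snd N" using assms(3) by (auto simp: less_eq_prod_def)
  then have "SS_upto r Z a = (\<Sum>\<iota>\<in>increasing_upto (dim_row a) (fst N). \<Sum>\<kappa>\<in>increasing_upto (dim_col a) (snd N).
      of_bool (\<iota> (dim_row a - 1) \<in> {1..fst r} \<and> \<kappa> (dim_col a - 1) \<in> {1..snd r}) *
      (1 * SS_term Z a \<iota> \<kappa>))"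
    unfolding SS_upto_def sum.cartesian_product
      increasing_upto_restrict[OF assms(1) \<open>fst r \<le> fst N\<close>]
      increasing_upto_restrict[OF assms(2) \<open>snd r \<le> snd N\<close>]
    by (intro sum.mono_neutral_cong_left) (auto simp: of_bool_def split: if_splits)
  then show ?thesis
    by (simp only: sum_transfer[OF finite_atLeastAtMost finite_atLeastAtMost])
qed

text \<open>
  For every index of a row or column there is a non-neutral entry, and its factor vanishes as soon as
  the index exceeds the size of the input.
\<close>

lemma SS_eq_SS_upto:
  fixes Z :: "nat \<times> nat \<Rightarrow> 'k::comm_semiring_1 ^ 'd::finite"
  assumes "a \<in> compositions" "Z \<in> evZ"
  shows "SS Z a = SS_upto (ev_size Z) Z a"
proof -
  let ?g = "\<lambda>(\<iota>, \<kappa>). if \<iota> \<in> increasing (dim_row a) \<and> \<kappa> \<in> increasing (dim_col a)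
    then SS_term Z a \<iota> \<kappa> else 0"
  let ?A = "increasing_upto (dim_row a) (fst (ev_size Z)) \<times> increasing_upto (dim_col a) (snd (ev_size Z))"
  have upto: "\<iota> \<in> increasing_upto m n" if "\<iota> \<in> increasing m" "\<And>i. i < m \<Longrightarrow> \<iota> i \<le> n" for \<iota> m n
    using that by (auto simp: increasing_def increasing_upto_def PiE_def Pi_def)
  have incr: "increasing_upto m n \<subseteq> increasing m" for m n
    by (fastforce simp: increasing_def increasing_upto_def)
  have bound: "\<iota> s \<le> fst (ev_size Z) \<and> \<kappa> t \<le> snd (ev_size Z)"
    if nz: "SS_term Z a \<iota> \<kappa> \<noteq> 0" and s: "s < dim_row a" and t: "t < dim_col a"
      and e: "a $$ (s, t) \<noteq> {#}" for \<iota> \<kappa> s t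
  proof -
    have "Z (\<iota> s, \<kappa> t) \<noteq> 0"
    proof
      assume "Z (\<iota> s, \<kappa> t) = 0"
      moreover obtain x where "x \<in># a $$ (s, t)" using e by blast
      ultimately have "monomial_value (Z (\<iota> s, \<kappa> t)) (a $$ (s, t)) = 0"
        by (auto simp: monomial_value_def dest!: multi_member_split)
      then have "(\<Prod>t<dim_col a. monomial_value (Z (\<iota> s, \<kappa> t)) (a $$ (s, t))) = 0"
        using t by (intro prod_zero) auto
      then have "SS_term Z a \<iota> \<kappa> = 0"
        unfolding SS_term_def using s by (intro prod_zero) auto
      then show False using nz by simp
    qed
    then show ?thesis using ev_size_least(2)[OF assms(2)] by (force simp: less_eq_prod_def)
  qed
  have "Sum_any ?g = sum ?g ?A"
  proof (rule Sum_any.expand_superset)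
    show "{p. ?g p \<noteq> 0} \<subseteq> ?A"
    proof clarify
      fix \<iota> \<kappa>
      assume "(if \<iota> \<in> increasing (dim_row a) \<and> \<kappa> \<in> increasing (dim_col a)
        then SS_term Z a \<iota> \<kappa> else 0) \<noteq> 0"
      then have inc: "\<iota> \<in> increasing (dim_row a)" "\<kappa> \<in> increasing (dim_col a)"
        and nz: "SS_term Z a \<iota> \<kappa> \<noteq> 0" by (auto split: if_splits)
      have "\<iota> s \<le> fst (ev_size Z)" if "s < dim_row a" for s
        using assms(1) that bound[OF nz that] by (auto simp: compositions_def)
      moreover have "\<kappa> t \<le> snd (ev_size Z)" if "t < dim_col a" for t
        using assms(1) that bound[OF nz _ that] by (auto simp: compositions_def)
      ultimately show "\<iota> \<in> increasing_upto (dim_row a) (fst (ev_size Z)) \<and>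
          \<kappa> \<in> increasing_upto (dim_col a) (snd (ev_size Z))"
        using inc upto by blast
    qed
  qed simp
  also have "\<dots> = SS_upto (ev_size Z) Z a"
    unfolding SS_upto_def by (intro sum.cong) (auto dest: incr[THEN subsetD])
  finally show ?thesis by (simp add: SS_def)
qed

lemma transfer_single:
  assumes "q \<in> {1..fst N} \<times> {1..snd N}"
  shows "transfer N Z (mat 1 1 (\<lambda>_. l)) G q = G q * monomial_value (Z q) l"
proof -
  let ?c = "\<lambda>x :: nat. restrict (\<lambda>_. x) {..<1 :: nat}"
  have inc: "increasing_upto 1 n = ?c ` {1..n}" for n
  proof (intro subset_antisym subsetI)
    fix \<iota> assume \<iota>: "\<iota> \<in> increasing_upto 1 n"
    then have "\<iota> = ?c (\<iota> 0)" "\<iota> 0 \<in> {1..n}"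
      by (auto simp: increasing_upto_def PiE_def extensional_def fun_eq_iff)
    then show "\<iota> \<in> ?c ` {1..n}" by blast
  qed (auto simp: increasing_upto_def strict_mono_on_def PiE_def)
  have inj: "inj_on ?c A" for A
    by (auto simp: inj_on_def fun_eq_iff)
  have "transfer N Z (mat 1 1 (\<lambda>_. l)) G q =
      (\<Sum>(i, j)\<in>{1..fst N} \<times> {1..snd N}. if (i, j) = q then G q * monomial_value (Z q) l else 0)"
    unfolding transfer_def dim_row_mat dim_col_mat inc sum.reindex[OF inj] o_def
    unfolding sum.cartesian_product by (rule sum.cong) (auto simp: SS_term_def)
  also have "\<dots> = G q * monomial_value (Z q) l"
    using assms by (simp add: case_prod_unfold)
  finally show ?thesis .
qed

section \<open>The cost of transfer operators\<close>

abbreviation grid :: "nat \<times> nat \<Rightarrow> (nat \<times> nat) set" where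
  "grid N \<equiv> {1..fst N} \<times> {1..snd N}"

text \<open>
  Along each of the lines \<open>g x\<close>, the sums over the sets \<open>B j\<close> are partial sums or single entries. Both
  cases occur for \<^const>\<open>before\<close>, and initial intervals are needed for the final summation.
\<close>

lemma computable_within_interval_sums:
  assumes "finite A" "computable_within m F" "\<And>x j. x \<in> A \<Longrightarrow> j \<in> {1..n} \<Longrightarrow> g x j \<in> F" "1 \<le> n"
    and B: "\<And>j. j \<in> {1..n} \<Longrightarrow> B j = {j} \<or> (\<exists>k\<le>n. B j = {1..k})"
  shows "computable_within (m + 2 * card A * n)
    ((\<lambda>(x, j) Z. \<Sum>j'\<in>B j. g x j' Z) ` (A \<times> {1..n}) \<union> F)"
proof -
  let ?F = "(\<Union>x\<in>A. (\<lambda>k Z. \<Sum>j\<in>{1..k}. g x j Z) ` {..n}) \<union> F"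
  have mem: "(\<lambda>Z. \<Sum>j'\<in>B j. g x j' Z) \<in> ?F" if "x \<in> A" "j \<in> {1..n}" for x j
    using B[OF that(2)]
  proof
    assume "B j = {j}"
    then show ?thesis using assms(3)[OF that] by simp
  next
    assume "\<exists>k\<le>n. B j = {1..k}"
    then obtain k where "k \<le> n" "B j = {1..k}" by blast
    then have "(\<lambda>Z. \<Sum>j'\<in>B j. g x j' Z) \<in> (\<lambda>k Z. \<Sum>j\<in>{1..k}. g x j Z) ` {..n}" by auto
    then show ?thesis using that(1) by blast
  qed
  have "(\<lambda>(x, j) Z. \<Sum>j'\<in>B j. g x j' Z) ` (A \<times> {1..n}) \<union> F \<subseteq> ?F"
  proof (intro Un_least image_subsetI)
    fix p assume "p \<in> A \<times> {1..n}"
    then obtain x j where "p = (x, j)" "x \<in> A" "j \<in> {1..n}" by blast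
    then show "(case p of (x, j) \<Rightarrow> \<lambda>Z. \<Sum>j'\<in>B j. g x j' Z) \<in> ?F"
      using mem[of x j] by simp
  qed simp
  moreover have "computable_within (m + 2 * card A * n) ?F"
    using assms(1-4) by (rule computable_within_partial_sums_family)
  ultimately show ?thesis using computable_within_mono[OF _ order_refl] by blast
qed

text \<open>
  If the values of \<open>G\<close> on the box are available, then \<open>c\<close> more operations suffice for the values of
  \<open>T G\<close> on the box. In this form costs of operators add up under composition, and nothing already
  computed is lost.
\<close>

definition operator_cost ::
  "nat \<times> nat \<Rightarrow> (('k::comm_ring_1, 'd::finite) input \<Rightarrow> (nat \<times> nat \<Rightarrow> 'k) \<Rightarrow> nat \<times> nat \<Rightarrow> 'k) \<Rightarrow> nat \<Rightarrow> bool"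
  where "operator_cost N T c \<longleftrightarrow> (\<forall>m F G. computable_within m F \<longrightarrow> G ` grid N \<subseteq> F \<longrightarrow>
    computable_within (m + c) ((\<lambda>q Z. T Z (\<lambda>u. G u Z) q) ` grid N \<union> F))"

lemma operator_costI:
  assumes "\<And>m F G. computable_within m F \<Longrightarrow> G ` grid N \<subseteq> F \<Longrightarrow>
    computable_within (m + c) ((\<lambda>q Z. T Z (\<lambda>u. G u Z) q) ` grid N \<union> F)"
  shows "operator_cost N T c"
  using assms by (simp add: operator_cost_def)

lemma operator_costD:
  assumes "operator_cost N T c" "computable_within m F" "G ` grid N \<subseteq> F"
  shows "computable_within (m + c) ((\<lambda>q Z. T Z (\<lambda>u. G u Z) q) ` grid N \<union> F)"
  using assms unfolding operator_cost_def by blast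

lemma operator_cost_mono:
  fixes T :: "('k::comm_ring_1, 'd::finite) input \<Rightarrow> (nat \<times> nat \<Rightarrow> 'k) \<Rightarrow> nat \<times> nat \<Rightarrow> 'k"
  assumes "operator_cost N T c" "c \<le> c'"
  shows "operator_cost N T c'"
proof (rule operator_costI)
  fix m F and G :: "nat \<times> nat \<Rightarrow> ('k, 'd) input \<Rightarrow> 'k"
  assume "computable_within m F" "G ` grid N \<subseteq> F"
  from operator_costD[OF assms(1) this]
  show "computable_within (m + c') ((\<lambda>q Z. T Z (\<lambda>u. G u Z) q) ` grid N \<union> F)"
    by (rule computable_within_mono) (use assms(2) in auto)
qed

lemma operator_cost_comp:
  fixes S T :: "('k::comm_ring_1, 'd::finite) input \<Rightarrow> (nat \<times> nat \<Rightarrow> 'k) \<Rightarrow> nat \<times> nat \<Rightarrow> 'k"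
  assumes "operator_cost N S c" "operator_cost N T c'"
  shows "operator_cost N (\<lambda>Z G. T Z (S Z G)) (c + c')"
proof (rule operator_costI)
  fix m F and G :: "nat \<times> nat \<Rightarrow> ('k, 'd) input \<Rightarrow> 'k"
  assume "computable_within m F" "G ` grid N \<subseteq> F"
  then have "computable_within (m + c) ((\<lambda>q Z. S Z (\<lambda>u. G u Z) q) ` grid N \<union> F)"
    by (rule operator_costD[OF assms(1)])
  from operator_costD[OF assms(2) this Un_upper1]
  show "computable_within (m + (c + c')) ((\<lambda>q Z. T Z (S Z (\<lambda>u. G u Z)) q) ` grid N \<union> F)"
    by (rule computable_within_mono) auto
qed

text \<open>
  Double sums over rectangles separate: partial sums along the rows, and then partial sums of the
  results along the columns.
\<close>

lemma operator_cost_rectangle_sums: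
  assumes "(1, 1) \<le> N"
    and B: "\<And>i. i \<in> {1..fst N} \<Longrightarrow> B i = {i} \<or> (\<exists>k\<le>fst N. B i = {1..k})"
    and B': "\<And>j. j \<in> {1..snd N} \<Longrightarrow> B' j = {j} \<or> (\<exists>k\<le>snd N. B' j = {1..k})"
  shows "operator_cost N (\<lambda>(Z :: ('k::comm_ring_1, 'd::finite) input) G v. \<Sum>i\<in>B (fst v). \<Sum>j\<in>B' (snd v). G (i, j)) (4 * (fst N * snd N))"
proof (rule operator_costI)
  fix m F and G :: "nat \<times> nat \<Rightarrow> ('k, 'd) input \<Rightarrow> 'k"
  assume F: "computable_within m F" and G: "G ` grid N \<subseteq> F"
  have N: "1 \<le> fst N" "1 \<le> snd N" using assms(1) by (auto simp: less_eq_prod_def)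
  let ?F = "(\<lambda>(i, j) Z. \<Sum>j'\<in>B' j. G (i, j') Z) ` grid N \<union> F"
  have "computable_within (m + 2 * card {1..fst N} * snd N) ?F"
    by (rule computable_within_interval_sums) (use F G B' N in auto)
  then have "computable_within (m + 2 * card {1..fst N} * snd N + 2 * card {1..snd N} * fst N)
      ((\<lambda>(j, i) Z. \<Sum>i'\<in>B i. (\<lambda>Z. \<Sum>j'\<in>B' j. G (i', j') Z) Z) ` ({1..snd N} \<times> {1..fst N}) \<union> ?F)"
    by (rule computable_within_interval_sums[OF finite_atLeastAtMost _ _ N(1) B]) auto
  then show "computable_within (m + 4 * (fst N * snd N))
    ((\<lambda>v Z. \<Sum>i\<in>B (fst v). \<Sum>j\<in>B' (snd v). G (i, j) Z) ` grid N \<union> F)"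
    by (rule computable_within_mono) (auto simp: image_iff)
qed

lemma before_cases:
  assumes "i \<in> {1..n}"
  shows "before d i = {i} \<or> (\<exists>k\<le>n. before d i = {1..k})"
proof (cases "d = 0")
  case True
  have "{1..<i} = {1..i - 1}" using assms by auto
  then show ?thesis using True assms by (auto simp: before_def intro!: exI[of _ "i - 1"])
qed (simp add: before_def)

lemma operator_cost_step:
  "(1, 1) \<le> N \<Longrightarrow> operator_cost N (\<lambda>Z. step d e) (4 * (fst N * snd N))"
  unfolding step_def by (intro operator_cost_rectangle_sums before_cases)

lemma operator_cost_transfer_single:
  fixes l :: "'d::finite multiset"
  shows "operator_cost N (\<lambda>Z :: ('k::comm_ring_1, 'd) input. transfer N Z (mat 1 1 (\<lambda>_. l)))
    (2 * (fst N * snd N))"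
proof (rule operator_costI)
  fix m and F and G :: "nat \<times> nat \<Rightarrow> ('k, 'd) input \<Rightarrow> 'k"
  assume F: "computable_within m F" and G: "G ` grid N \<subseteq> F"
  \<comment> \<open>Two operations per point: evaluate the factor, and multiply.\<close>
  let ?new = "\<lambda>q. {\<lambda>Z. G q Z * monomial_value (Z q) l, \<lambda>Z. monomial_value (Z q) l}"
  have "computable_within (m + card (grid N) * 2) ((\<Union>q\<in>grid N. ?new q) \<union> F)"
  proof (rule computable_within_family[OF _ F])
    fix q n F'
    assume q: "q \<in> grid N" and F': "F \<subseteq> F'" "computable_within n F'"
    have "computable_within (Suc n) (insert (\<lambda>Z. monomial_value (Z q) l) F')"
      using F'(2) q by (intro computable_within_factor) (auto simp: less_eq_prod_def)
    then have "computable_within (Suc (Suc n)) (insert (\<lambda>Z. G q Z * monomial_value (Z q) l)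
        (insert (\<lambda>Z. monomial_value (Z q) l) F'))"
      by (rule computable_within_mult) (use q F' G in auto)
    then show "computable_within (n + 2) (?new q \<union> F')" by simp
  qed simp
  then show "computable_within (m + 2 * (fst N * snd N))
      ((\<lambda>q Z. transfer N Z (mat 1 1 (\<lambda>_. l)) (\<lambda>u. G u Z) q) ` grid N \<union> F)"
  proof (rule computable_within_mono)
    show "(\<lambda>q Z. transfer N Z (mat 1 1 (\<lambda>_. l)) (\<lambda>u. G u Z) q) ` grid N \<union> F \<subseteq>
        (\<Union>q\<in>grid N. ?new q) \<union> F"
    proof (intro Un_mono subset_refl image_subsetI UN_I)
      fix q assume "q \<in> grid N"
      then show "(\<lambda>Z. transfer N Z (mat 1 1 (\<lambda>_. l)) (\<lambda>u. G u Z) q) \<in> ?new q"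
        by (simp only: transfer_single insert_iff simp_thms)
    qed
  qed simp
qed

lemma operator_cost_transfer_glue:
  fixes a b :: "'d::finite multiset mat"
  assumes "1 \<le> dim_row a" "1 \<le> dim_col a" "1 \<le> dim_row b" "1 \<le> dim_col b" "d + e \<le> 1"
    and N: "(1, 1) \<le> N"
    and ca: "operator_cost N (\<lambda>Z :: ('k::comm_ring_1, 'd) input. transfer N Z a) ca"
    and cb: "operator_cost N (\<lambda>Z :: ('k, 'd) input. transfer N Z b) cb"
  shows "operator_cost N (\<lambda>Z :: ('k, 'd) input. transfer N Z (glue d e a b))
    (ca + 4 * (fst N * snd N) + cb)"
  unfolding transfer_glue[OF assms(1-5), abs_def]
  by (rule operator_cost_comp[OF operator_cost_comp[OF ca operator_cost_step[OF N]] cb])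

text \<open>
  A single block needs \<open>2\<close> operations per point of the box and each link \<open>4\<close>, hence \<open>6 k - 4\<close> for \<open>k\<close>
  blocks. The number of blocks itself is not a function of the dimensions, since a diagonal
  link adds a row and a column; but \<open>rows + cols - 1\<close> bounds it, as it is \<open>1\<close> for one block and
  superadditive under gluing along at most one row or column.
\<close>

lemma operator_cost_transfer_chained:
  fixes a :: "'d::finite multiset mat"
  assumes "a \<in> chained" and N: "(1, 1) \<le> N"
  shows "operator_cost N (\<lambda>Z :: ('k::comm_ring_1, 'd) input. transfer N Z a)
    ((6 * (dim_row a + dim_col a - 1) - 4) * (fst N * snd N))" (is "?P a")
proof -
  have glue: "?P (glue d e a b)"
    if a: "a \<in> chained" "?P a" and b: "b \<in> chained" "?P b" and de: "d + e \<le> 1" for d e a b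
  proof (rule operator_cost_mono[OF operator_cost_transfer_glue[OF _ _ _ _ de N a(2) b(2)]])
    have dims: "1 \<le> dim_row a" "1 \<le> dim_col a" "1 \<le> dim_row b" "1 \<le> dim_col b"
      using chained_dims a(1) b(1) by auto
    then show "1 \<le> dim_row a" "1 \<le> dim_col a" "1 \<le> dim_row b" "1 \<le> dim_col b" by auto
    show "(6 * (dim_row a + dim_col a - 1) - 4) * (fst N * snd N) + 4 * (fst N * snd N)
        + (6 * (dim_row b + dim_col b - 1) - 4) * (fst N * snd N)
      \<le> (6 * (dim_row (glue d e a b) + dim_col (glue d e a b) - 1) - 4) * (fst N * snd N)"
      unfolding distrib_right[symmetric] using dims de by (intro mult_le_mono1) auto
  qed
  show ?thesis
    using assms(1)
  proof induction
    case (single l)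
    then show ?case using operator_cost_transfer_single[of N l] by simp
  next
    case (chain0 a b)
    then show ?case unfolding chain_glue by (intro glue) auto
  next
    case (chain1 a b)
    then show ?case unfolding chain_glue by (intro glue) auto
  next
    case (chain2 a b)
    then show ?case unfolding chain_glue by (intro glue) auto
  qed
qed

section \<open>Evaluation in linear time\<close>

text \<open>
  The transfer of the constant \<open>1\<close>, which costs one operation to create, followed by one more summation
  over rectangles; the estimate \<open>rows + cols - 1 \<le> rows \<cdot> cols\<close> turns the count into the product of
  the four dimensions.
\<close>

lemma SS_upto_linear_time:
  fixes a :: "'d::finite multiset mat"
  assumes a: "a \<in> chained" and N: "(1, 1) \<le> N"
  shows "computable_within (7 * (dim_row a * dim_col a * fst N * snd N))
    ((\<lambda>r (Z :: ('k::comm_ring_1, 'd) input). SS_upto r Z a) ` grid N)"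
proof -
  let ?c = "6 * (dim_row a + dim_col a - 1) - 4" and ?RC = "fst N * snd N"
  have dims: "1 \<le> dim_row a" "1 \<le> dim_col a" using chained_dims[OF a] by auto
  have RC: "1 \<le> ?RC" using N by (auto simp: less_eq_prod_def)
  have one: "computable_within 1 {\<lambda>Z :: ('k, 'd) input. 1 :: 'k}"
    using computable_within_one[OF computable_within_empty] by simp
  have cost: "operator_cost N (\<lambda>(Z :: ('k, 'd) input) G v.
      \<Sum>i\<in>{1..fst v}. \<Sum>j\<in>{1..snd v}. transfer N Z a G (i, j)) (?c * ?RC + 4 * ?RC)"
    by (rule operator_cost_comp[OF operator_cost_transfer_chained[OF a N]
          operator_cost_rectangle_sums[OF N]]) auto
  \<comment> \<open>Equivalent to 0 \<le> (rows - 1) (cols - 1).\<close>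
  have "dim_row a + dim_col a - 1 \<le> dim_row a * dim_col a"
  proof -
    obtain m n where "dim_row a = Suc m" "dim_col a = Suc n"
      using dims by (metis Suc_le_D One_nat_def)
    then show ?thesis by simp
  qed
  then have "1 + (?c + 4) \<le> 7 * (dim_row a * dim_col a)" using dims by linarith
  then have "(1 + (?c + 4)) * ?RC \<le> 7 * (dim_row a * dim_col a) * ?RC" by (rule mult_le_mono1)
  moreover have "1 + (?c * ?RC + 4 * ?RC) \<le> (1 + (?c + 4)) * ?RC"
    using RC by (simp only: distrib_right)
  ultimately have "1 + (?c * ?RC + 4 * ?RC) \<le> 7 * (dim_row a * dim_col a * fst N * snd N)"
    by (simp only: mult.assoc)
  moreover have "SS_upto r Z a = (\<Sum>i\<in>{1..fst r}. \<Sum>j\<in>{1..snd r}. transfer N Z a (\<lambda>_. 1) (i, j))"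
    if "r \<in> grid N" for r and Z :: "('k, 'd) input"
    by (rule SS_upto_eq_sum_transfer[OF dims]) (use that in \<open>auto simp: less_eq_prod_def\<close>)
  ultimately show ?thesis
    by (intro computable_within_mono[OF operator_costD[OF cost one, of "\<lambda>_ _. 1"]]) auto
qed

theorem theorem4p5:
  shows "(\<exists>(alg :: 'd::finite multiset mat \<Rightarrow> nat \<times> nat \<Rightarrow> 'd program)
            (out :: 'd multiset mat \<Rightarrow> nat \<times> nat \<Rightarrow> nat \<times> nat \<Rightarrow> nat) (C :: nat).
          \<forall>a\<in>chained. \<forall>Z\<in>(evZ :: (nat \<times> nat \<Rightarrow> 'k::idom ^ 'd) set).
            length (alg a (ev_size Z))
              \<le> C * (dim_row a * dim_col a * fst (ev_size Z) * snd (ev_size Z)) \<and>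
            (\<forall>r. (1, 1) \<le> r \<and> r \<le> ev_size Z \<longrightarrow>
               computes (alg a (ev_size Z)) Z (out a (ev_size Z) r) (SS_upto r Z a)))
       \<and> (\<exists>(alg :: 'd multiset mat \<Rightarrow> nat \<times> nat \<Rightarrow> 'd program)
            (out :: 'd multiset mat \<Rightarrow> nat \<times> nat \<Rightarrow> nat) (C :: nat).
          \<forall>a\<in>chained. \<forall>Z\<in>(evZ :: (nat \<times> nat \<Rightarrow> 'k ^ 'd) set).
            length (alg a (ev_size Z))
              \<le> C * (dim_row a * dim_col a * fst (ev_size Z) * snd (ev_size Z)) \<and>
            computes (alg a (ev_size Z)) Z (out a (ev_size Z)) (SS Z a))"
proof -
  have "\<exists>p :: 'd program. length p \<le> 7 * (dim_row a * dim_col a * fst N * snd N) \<and>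
      (\<forall>r. \<exists>k. (1, 1) \<le> r \<and> r \<le> N \<longrightarrow>
        (\<forall>Z :: ('k, 'd) input. computes p Z k (SS_upto r Z a)))"
    if aN: "a \<in> chained" "(1, 1) \<le> N" for a N
  proof -
    obtain p :: "'d program" where p: "length p \<le> 7 * (dim_row a * dim_col a * fst N * snd N)"
      "\<forall>f \<in> (\<lambda>r (Z :: ('k, 'd) input). SS_upto r Z a) ` grid N. \<exists>k. \<forall>Z. computes p Z k (f Z)"
      using SS_upto_linear_time[OF aN, where 'k = 'k] unfolding computable_within_def by blast
    have "r \<in> grid N" if "(1, 1) \<le> r \<and> r \<le> N" for r
      using that by (cases r) (auto simp: less_eq_prod_def)
    then have "\<exists>k. \<forall>Z :: ('k, 'd) input. computes p Z k (SS_upto r Z a)"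
      if "(1, 1) \<le> r \<and> r \<le> N" for r
      using bspec[OF p(2) imageI] that by blast
    then have "\<exists>k. (1, 1) \<le> r \<and> r \<le> N \<longrightarrow> (\<forall>Z :: ('k, 'd) input. computes p Z k (SS_upto r Z a))" for r
      by blast
    then show ?thesis using p(1) by blast
  qed
  then obtain alg :: "'d multiset mat \<Rightarrow> nat \<times> nat \<Rightarrow> 'd program" where alg:
    "\<And>a N. a \<in> chained \<Longrightarrow> (1, 1) \<le> N \<Longrightarrow>
      length (alg a N) \<le> 7 * (dim_row a * dim_col a * fst N * snd N) \<and>
      (\<forall>r. \<exists>k. (1, 1) \<le> r \<and> r \<le> N \<longrightarrow>
        (\<forall>Z :: ('k, 'd) input. computes (alg a N) Z k (SS_upto r Z a)))"
    by metis
  then obtain out where out: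
    "\<And>a N r (Z :: ('k, 'd) input). a \<in> chained \<Longrightarrow> (1, 1) \<le> N \<Longrightarrow> (1, 1) \<le> r \<Longrightarrow> r \<le> N \<Longrightarrow>
      computes (alg a N) Z (out a N r) (SS_upto r Z a)"
    by metis
  have size: "(1, 1) \<le> ev_size Z" if "Z \<in> evZ" for Z :: "('k, 'd) input"
    using ev_size_least(1)[OF that] .
  have total: "SS Z a = SS_upto (ev_size Z) Z a" if "a \<in> chained" "Z \<in> evZ"
    for a and Z :: "('k, 'd) input"
    using SS_eq_SS_upto that chained_subset_compositions by blast
  show ?thesis
  proof (intro conjI exI[of _ alg] exI[of _ out] exI[of _ "\<lambda>a N. out a N N"] exI[of _ 7] ballI allI impI)
  qed (use alg out size total in auto)
qed

end
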